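(* Let $M=(U,C,E,\vec N,\vec I,\vec R)$ be a market with size-interchangeable bidders and let $X=(x_{ij})$ be a feasible allocation in which every bidder $j$ receives either a bundle of total size exactly $I_j$ or the empty bundle. Let $W=\{j\in C : \sum_{i} x_{ij}\ge I_j\}$ be the set of winners. Then a price vector $p\in\mathbb{R}_{\ge 0}^{U}$ is restricted envy-free with respect to $X$ if and only if both of the following conditions hold: (Individual Rationality) for all $j\in W$: $P_j(X_j)\le V_j(X_j)$; (Compact Condition) for all $i\in U$ and $j\in C$ with $x_{ij}>0$, and for all $k\in U$ with $(k,j)\in E$ and $x_{kj}<N_k$: $p_i\le p_k$.
   Context: A market (centralized combinatorial matching market) $M=(U,C,E,\vec N,\vec I,\vec R)$ consists of a finite set $U$ of $n$ types of goods, a finite set $C$ of $m$ bidders, a set $E\subseteq U\times C$ of edges indicating which goods are of interest to which bidders, positive integers $N_i$ ($i\in U$; number of copies of good $i$), positive integers $I_j$ ($j\in C$; total number of goods demanded by bidder $j$) and rewards $R_j>0$ ($j\in C$). An allocation is a labeling of the edges by non-negative integers, written as a matrix $X=(x_{ij})_{i\in U,j\in C}$ with $x_{ij}\in\mathbb{Z}_{\ge0}$ and $x_{ij}=0$ whenever $(i,j)\notin E$; $x_{ij}$ is the number of copies of good $i$ given to bidder $j$. It is feasible if $\sum_{j} x_{ij}\le N_i$ for all $i\in U$. The column $X_j$ is bidder $j$'s bundle, an element of $B(\vec N)=\prod_{i\in U}\{0,1,\dots,N_i\}$, and $|X_j|=\sum_i x_{ij}$. Bidders are size-interchangeable: for any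 bundle $Y=(y_i)_{i\in U}\in B(\vec N)$, $V_j(Y)=R_j$ if $\sum_{i:(i,j)\in E} y_i\ge I_j$, and $V_j(Y)=0$ otherwise. Given prices $p$, the cost of a bundle $Y$ is $P_j(Y)=\sum_i y_i p_i$. For a bundle $X_j$ let $B(\vec N_{|X_j|})=\{\mathbf 0\}\cup\{Y\in B(\vec N): |Y|=|X_j|\}$. A price vector $p$ is restricted envy-free with respect to a feasible allocation $X$ if for all $j$ with $|X_j|>0$, $$X_j\in\arg\max_{Y\in B(\vec N_{|X_j|})}\{V_j(Y)-P_j(Y)\}.$$ *)

theory Defs
  imports "HOL-Analysis.Analysis"
begin

record ('g, 'b) market_data =
  goods :: "'g set"
  bidders :: "'b set"
  edges :: "('g \<times> 'b) set"
  copies :: "'g \<Rightarrow> nat"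
  demand :: "'b \<Rightarrow> nat"
  reward :: "'b \<Rightarrow> real"

definition market :: "('g, 'b) market_data \<Rightarrow> bool" where
  "market M \<longleftrightarrow>
     finite (goods M) \<and> finite (bidders M) \<and>
     edges M \<subseteq> goods M \<times> bidders M \<and>
     (\<forall>i\<in>goods M. 0 < copies M i) \<and>
     (\<forall>j\<in>bidders M. 0 < demand M j) \<and>
     (\<forall>j\<in>bidders M. 0 < reward M j)"

text \<open>An allocation is a matrix of type \<^typ>\<open>'g \<Rightarrow> 'b \<Rightarrow> nat\<close>; only its entries in
  goods times bidders are ever consulted.\<close>

definition allocation :: "('g, 'b) market_data \<Rightarrow> ('g \<Rightarrow> 'b \<Rightarrow> nat) \<Rightarrow> bool" where
  "allocation M X \<longleftrightarrow>
     (\<forall>i\<in>goods M. \<forall>j\<in>bidders M. (i, j) \<notin> edges M \<longrightarrow> X i j = 0)"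

definition feasible :: "('g, 'b) market_data \<Rightarrow> ('g \<Rightarrow> 'b \<Rightarrow> nat) \<Rightarrow> bool" where
  "feasible M X \<longleftrightarrow> allocation M X \<and> (\<forall>i\<in>goods M. (\<Sum>j\<in>bidders M. X i j) \<le> copies M i)"

text \<open>Bundles are elements of the extensional product over the goods, so columns of an
  allocation and the empty bundle are restricted to the goods.\<close>

definition bundles :: "('g, 'b) market_data \<Rightarrow> ('g \<Rightarrow> nat) set" where
  "bundles M = (\<Pi>\<^sub>E i\<in>goods M. {0..copies M i})"

definition bundle_of :: "('g, 'b) market_data \<Rightarrow> ('g \<Rightarrow> 'b \<Rightarrow> nat) \<Rightarrow> 'b \<Rightarrow> 'g \<Rightarrow> nat" where
  "bundle_of M X j = (\<lambda>i\<in>goods M. X i j)"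

definition empty_bundle :: "('g, 'b) market_data \<Rightarrow> 'g \<Rightarrow> nat" where
  "empty_bundle M = (\<lambda>i\<in>goods M. 0)"

definition bundle_size :: "('g, 'b) market_data \<Rightarrow> ('g \<Rightarrow> nat) \<Rightarrow> nat" where
  "bundle_size M Y = (\<Sum>i\<in>goods M. Y i)"

text \<open>The valuation of a size-interchangeable bidder.\<close>

definition valuation :: "('g, 'b) market_data \<Rightarrow> 'b \<Rightarrow> ('g \<Rightarrow> nat) \<Rightarrow> real" where
  "valuation M j Y =
     (if demand M j \<le> (\<Sum>i | i \<in> goods M \<and> (i, j) \<in> edges M. Y i) then reward M j else 0)"

definition cost :: "('g, 'b) market_data \<Rightarrow> ('g \<Rightarrow> real) \<Rightarrow> ('g \<Rightarrow> nat) \<Rightarrow> real" where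
  "cost M p Y = (\<Sum>i\<in>goods M. real (Y i) * p i)"

definition restricted_bundles :: "('g, 'b) market_data \<Rightarrow> nat \<Rightarrow> ('g \<Rightarrow> nat) set" where
  "restricted_bundles M k = {empty_bundle M} \<union> {Y \<in> bundles M. bundle_size M Y = k}"

definition restricted_envy_free ::
  "('g, 'b) market_data \<Rightarrow> ('g \<Rightarrow> 'b \<Rightarrow> nat) \<Rightarrow> ('g \<Rightarrow> real) \<Rightarrow> bool" where
  "restricted_envy_free M X p \<longleftrightarrow>
     (\<forall>j\<in>bidders M. 0 < bundle_size M (bundle_of M X j) \<longrightarrow>
        is_arg_max (\<lambda>Y. valuation M j Y - cost M p Y)
          (\<lambda>Y. Y \<in> restricted_bundles M (bundle_size M (bundle_of M X j)))
          (bundle_of M X j))"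

definition winners :: "('g, 'b) market_data \<Rightarrow> ('g \<Rightarrow> 'b \<Rightarrow> nat) \<Rightarrow> 'b set" where
  "winners M X = {j \<in> bidders M. demand M j \<le> (\<Sum>i\<in>goods M. X i j)}"

definition individually_rational ::
  "('g, 'b) market_data \<Rightarrow> ('g \<Rightarrow> 'b \<Rightarrow> nat) \<Rightarrow> ('g \<Rightarrow> real) \<Rightarrow> bool" where
  "individually_rational M X p \<longleftrightarrow>
     (\<forall>j\<in>winners M X. cost M p (bundle_of M X j) \<le> valuation M j (bundle_of M X j))"

definition compact_condition ::
  "('g, 'b) market_data \<Rightarrow> ('g \<Rightarrow> 'b \<Rightarrow> nat) \<Rightarrow> ('g \<Rightarrow> real) \<Rightarrow> bool" where
  "compact_condition M X p \<longleftrightarrow>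
     (\<forall>i\<in>goods M. \<forall>j\<in>bidders M. 0 < X i j \<longrightarrow>
        (\<forall>k\<in>goods M. (k, j) \<in> edges M \<and> X k j < copies M k \<longrightarrow> p i \<le> p k))"

end

theory Submission
  imports Defs
begin

text \<open>Since a bundle of size \<^term>\<open>demand M j\<close> is worth \<^term>\<open>reward M j\<close> exactly when it is
  supported on the edges of \<^term>\<open>j\<close>, a winner compares her bundle only with the empty bundle
  (individual rationality), with worthless bundles (dominated by the empty one, as prices are
  nonnegative) and with edge-supported bundles of the same size. Passing to one of the latter
  replaces copies of goods by copies of goods that are no cheaper, by the compact condition.
  Conversely, exchanging a single copy recovers the compact condition.\<close>

text \<open>Since \<open>x\<close> and \<open>y\<close> have equal totals, all prices may be shifted
  by a common constant without changing the difference of the two costs. This reduces the claim to a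
  sign check term by term.\<close>

lemma sum_mult_le_of_exchange:
  fixes x y :: "'a \<Rightarrow> nat" and p :: "'a \<Rightarrow> real"
  assumes fin: "finite A"
    and eq: "sum x A = sum y A"
    and exch: "\<And>i k. \<lbrakk>i \<in> A; k \<in> A; y i < x i; x k < y k\<rbrakk> \<Longrightarrow> p i \<le> p k"
  shows "(\<Sum>i\<in>A. real (x i) * p i) \<le> (\<Sum>i\<in>A. real (y i) * p i)"
proof -
  text \<open>A price threshold separating the goods given up from the goods acquired.\<close>
  obtain t where lo: "\<And>i. \<lbrakk>i \<in> A; y i < x i\<rbrakk> \<Longrightarrow> p i \<le> t"
    and hi: "\<And>k. \<lbrakk>k \<in> A; x k < y k\<rbrakk> \<Longrightarrow> t \<le> p k"
  proof (cases "{i\<in>A. y i < x i} = {}")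
    case True
    \<comment> \<open>With nothing given up, \<open>lo\<close> is vacuous and any lower bound of the
      prices serves; a maximum over the empty set would be meaningless.\<close>
    obtain t where "\<And>k. k \<in> A \<Longrightarrow> t \<le> p k"
      using bdd_below_finite[of "p ` A"] fin by (auto simp: bdd_below_def)
    then show ?thesis using that True by blast
  next
    case False
    let ?S = "p ` {i\<in>A. y i < x i}"
    have S: "finite ?S" "?S \<noteq> {}" using fin False by auto
    show ?thesis
    proof (rule that[of "Max ?S"])
      show "p i \<le> Max ?S" if "i \<in> A" "y i < x i" for i
        using S that by (intro Max_ge) auto
      show "Max ?S \<le> p k" if "k \<in> A" "x k < y k" for k
        using S that exch by (subst Max_le_iff) auto
    qed
  qed
  \<comment> \<open>Both factors are \<le> 0 where a good is given up and \<ge> 0 where it is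
    acquired.\<close>
  have "0 \<le> (\<Sum>i\<in>A. (real (y i) - real (x i)) * (p i - t))"
  proof (rule sum_nonneg)
    fix i assume i: "i \<in> A"
    consider "y i < x i" | "x i < y i" | "x i = y i" by linarith
    then show "0 \<le> (real (y i) - real (x i)) * (p i - t)"
      using lo[OF i] hi[OF i] by cases (auto intro: mult_nonneg_nonneg mult_nonpos_nonpos)
  qed
  also have "\<dots> = (\<Sum>i\<in>A. real (y i) * p i) - (\<Sum>i\<in>A. real (x i) * p i)
      - (real (sum y A) - real (sum x A)) * t"
    by (simp add: algebra_simps sum.distrib sum_subtractf sum_distrib_left)
  finally show ?thesis using eq by simp
qed

text \<open>A size of exactly \<open>demand M j\<close> leaves no slack: a single copy of a good off
  the edges of \<open>j\<close> already pushes the useful part below the demand.\<close>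

lemma valuation_eq_of_bundle_size:
  assumes fin: "finite (goods M)" and size: "bundle_size M Y = demand M j"
  shows "valuation M j Y =
    (if \<forall>i\<in>goods M. 0 < Y i \<longrightarrow> (i, j) \<in> edges M then reward M j else 0)"
proof -
  let ?E = "{i \<in> goods M. (i, j) \<in> edges M}" and ?F = "{i \<in> goods M. (i, j) \<notin> edges M}"
  have "bundle_size M Y = sum Y (?E \<union> ?F)"
    unfolding bundle_size_def by (rule sum.cong) auto
  also have "\<dots> = sum Y ?E + sum Y ?F"
    using fin by (intro sum.union_disjoint) auto
  finally have "demand M j \<le> sum Y ?E \<longleftrightarrow> sum Y ?F = 0"
    using size by auto
  also have "\<dots> \<longleftrightarrow> (\<forall>i\<in>goods M. 0 < Y i \<longrightarrow> (i, j) \<in> edges M)"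
    using fin by auto
  finally show ?thesis by (simp add: valuation_def)
qed

lemma valuation_empty_bundle:
  assumes "0 < demand M j"
  shows "valuation M j (empty_bundle M) = 0"
  using assms by (simp add: valuation_def empty_bundle_def)

lemma cost_empty_bundle: "cost M p (empty_bundle M) = 0"
  by (simp add: cost_def empty_bundle_def)

lemma cost_nonneg: "(\<And>i. i \<in> goods M \<Longrightarrow> 0 \<le> p i) \<Longrightarrow> 0 \<le> cost M p Y"
  by (auto simp: cost_def intro: sum_nonneg)

lemma bundle_size_bundle_of: "bundle_size M (bundle_of M X j) = (\<Sum>i\<in>goods M. X i j)"
  by (simp add: bundle_size_def bundle_of_def)

lemma bundle_size_empty_bundle: "bundle_size M (empty_bundle M) = 0"
  by (simp add: bundle_size_def empty_bundle_def)

lemma bundle_of_in_bundles: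
  assumes "finite (bidders M)" "feasible M X" "j \<in> bidders M"
  shows "bundle_of M X j \<in> bundles M"
proof -
  have "X i j \<le> copies M i" if "i \<in> goods M" for i
    using assms that member_le_sum[of j "bidders M" "X i"]
    by (force simp: feasible_def)
  then show ?thesis by (auto simp: bundles_def bundle_of_def)
qed

lemma valuation_bundle_of:
  assumes "finite (goods M)" "feasible M X" "j \<in> bidders M"
    and "bundle_size M (bundle_of M X j) = demand M j"
  shows "valuation M j (bundle_of M X j) = reward M j"
  using assms by (auto simp: valuation_eq_of_bundle_size feasible_def allocation_def bundle_of_def)

text \<open>Serves both the size and the cost of a bundle in which one copy of \<open>i\<close> is
  traded for one of \<open>k\<close>. The goods must differ, as otherwise the second update would
  overwrite the first.\<close>

lemma sum_transfer_one:
  fixes f :: "'a \<Rightarrow> 'b::ab_group_add"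
  assumes "finite A" "i \<in> A" "k \<in> A" "i \<noteq> k"
  shows "sum (f(i := a, k := b)) A = sum f A - f i - f k + a + b"
proof -
  have "sum g A = g i + g k + sum g (A - {i, k})" for g :: "'a \<Rightarrow> 'b"
  proof -
    have "sum g A = g i + sum g (A - {i})" using assms by (simp add: sum.remove)
    also have "sum g (A - {i}) = g k + sum g (A - {i} - {k})"
      using assms by (intro sum.remove) auto
    also have "A - {i} - {k} = A - {i, k}" by auto
    finally show ?thesis by (simp add: add.assoc)
  qed
  from this[of f] this[of "f(i := a, k := b)"] assms show ?thesis
    by (simp add: algebra_simps)
qed

lemma bundle_size_exchange:
  assumes "finite (goods M)" "i \<in> goods M" "k \<in> goods M" "i \<noteq> k" "0 < Y i"
  shows "bundle_size M (Y(i := Y i - 1, k := Y k + 1)) = bundle_size M Y"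
proof -
  \<comment> \<open>Over \<open>int\<close> the subtraction is genuine; \<open>0 < Y i\<close> keeps
    the one on \<open>nat\<close> from truncating.\<close>
  have "int (bundle_size M (Y(i := Y i - 1, k := Y k + 1))) =
    sum ((\<lambda>l. int (Y l))(i := int (Y i) - 1, k := int (Y k) + 1)) (goods M)"
    unfolding bundle_size_def of_nat_sum using assms(5) by (intro sum.cong) auto
  also have "\<dots> = int (bundle_size M Y)"
    using assms by (subst sum_transfer_one) (auto simp: bundle_size_def)
  finally show ?thesis by simp
qed

lemma cost_exchange:
  assumes "finite (goods M)" "i \<in> goods M" "k \<in> goods M" "i \<noteq> k" "0 < Y i"
  shows "cost M p (Y(i := Y i - 1, k := Y k + 1)) = cost M p Y - p i + p k"
proof -
  have "cost M p (Y(i := Y i - 1, k := Y k + 1)) =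
    sum ((\<lambda>l. real (Y l) * p l)(i := (real (Y i) - 1) * p i, k := (real (Y k) + 1) * p k)) (goods M)"
    unfolding cost_def using assms(5) by (intro sum.cong) (auto simp: of_nat_diff)
  also have "\<dots> = cost M p Y - p i + p k"
    using assms by (subst sum_transfer_one) (auto simp: cost_def algebra_simps)
  finally show ?thesis .
qed

theorem theorem3p6:
  fixes M :: "('g, 'b) market_data"
    and X :: "'g \<Rightarrow> 'b \<Rightarrow> nat"
    and p :: "'g \<Rightarrow> real"
  assumes "market M"
    and "feasible M X"
    and "\<forall>j\<in>bidders M. bundle_size M (bundle_of M X j) = demand M j \<or> bundle_of M X j = empty_bundle M"
    and "\<forall>i\<in>goods M. 0 \<le> p i"
  shows "restricted_envy_free M X p \<longleftrightarrow> individually_rational M X p \<and> compact_condition M X p"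
proof (intro iffI conjI)
  have fin: "finite (goods M)" "finite (bidders M)"
    and pos: "\<And>j. j \<in> bidders M \<Longrightarrow> 0 < demand M j"
    using assms(1) by (auto simp: market_def)
  have size: "bundle_size M (bundle_of M X j) = demand M j"
    if "j \<in> bidders M" "0 < bundle_size M (bundle_of M X j)" for j
    using assms(3) that bundle_size_empty_bundle[of M] by force
  {
    assume ef: "restricted_envy_free M X p"
    have best: "valuation M j Y - cost M p Y
        \<le> valuation M j (bundle_of M X j) - cost M p (bundle_of M X j)"
      if "j \<in> bidders M" "0 < bundle_size M (bundle_of M X j)"
        "Y \<in> restricted_bundles M (bundle_size M (bundle_of M X j))" for j Y
      using ef that by (force simp: restricted_envy_free_def is_arg_max_linorder)
    show "individually_rational M X p"
      unfolding individually_rational_def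
    proof
      fix j assume "j \<in> winners M X"
      \<comment> \<open>Positive demand makes a winner's bundle nonempty, so envy-freeness applies
        to it; the empty bundle, of net value 0, is then a competitor.\<close>
      then have j: "j \<in> bidders M" and "0 < bundle_size M (bundle_of M X j)"
        using pos by (force simp: winners_def bundle_size_bundle_of)+
      then show "cost M p (bundle_of M X j) \<le> valuation M j (bundle_of M X j)"
        using best[of j "empty_bundle M"] pos
        by (simp add: valuation_empty_bundle cost_empty_bundle restricted_bundles_def)
    qed
    show "compact_condition M X p"
      unfolding compact_condition_def
    proof (intro ballI impI, elim conjE)
      fix i j k
      assume i: "i \<in> goods M" and j: "j \<in> bidders M" and Xi: "0 < X i j"
        and k: "k \<in> goods M" and kE: "(k, j) \<in> edges M" and Xk: "X k j < copies M k"
      define Z where "Z = bundle_of M X j"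
      \<comment> \<open>The competitor trades one copy of \<open>i\<close> for one of
        \<open>k\<close>. It has the same size and, as \<open>k\<close> is an edge good of
        \<open>j\<close>, the same value, so only \<open>p i\<close> and \<open>p k\<close> separate
        the two net values.\<close>
      define Y where "Y = Z(i := Z i - 1, k := Z k + 1)"
      have Zi: "0 < Z i" and Zk: "Z k < copies M k"
        using i k Xi Xk by (auto simp: Z_def bundle_of_def)
      have Zpos: "0 < bundle_size M Z"
        using fin i Zi sum_pos2[of "goods M" i Z] by (simp add: bundle_size_def)
      have Zsize: "bundle_size M Z = demand M j"
        using size j Zpos by (simp add: Z_def)
      have ZV: "valuation M j Z = reward M j"
        using valuation_bundle_of[OF fin(1) assms(2) j] Zsize by (simp add: Z_def)
      have ZE: "\<forall>l\<in>goods M. 0 < Z l \<longrightarrow> (l, j) \<in> edges M"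
        using assms(2) j by (force simp: Z_def feasible_def allocation_def bundle_of_def)
      show "p i \<le> p k"
      proof (cases "i = k")
        case False
        have Ysize: "bundle_size M Y = bundle_size M Z"
          unfolding Y_def using fin i k False Zi by (intro bundle_size_exchange)
        have "Z \<in> bundles M"
          using bundle_of_in_bundles[OF fin(2) assms(2) j] by (simp add: Z_def)
        \<comment> \<open>Only the entry at \<open>k\<close> grows, and \<open>Zk\<close> leaves
          room for one more copy.\<close>
        then have "Y \<in> bundles M"
          using i k Zk
          by (auto simp: Y_def bundles_def PiE_iff extensional_def intro: le_trans[OF diff_le_self])
        then have "valuation M j Y - cost M p Y \<le> valuation M j Z - cost M p Z"
          using best[of j Y] j Zpos Ysize by (simp add: Z_def restricted_bundles_def)
        moreover have "valuation M j Y = reward M j"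
          using valuation_eq_of_bundle_size[OF fin(1), of Y j] Ysize Zsize ZE kE Zi i
          by (auto simp: Y_def)
        moreover have "cost M p Y = cost M p Z - p i + p k"
          unfolding Y_def using fin i k False Zi by (intro cost_exchange)
        ultimately show ?thesis using ZV by simp
      qed simp
    qed
  }
  assume "individually_rational M X p \<and> compact_condition M X p"
  then have ir: "individually_rational M X p" and cc: "compact_condition M X p" by auto
  show "restricted_envy_free M X p"
    unfolding restricted_envy_free_def is_arg_max_linorder
  proof (intro ballI impI conjI allI)
    fix j assume j: "j \<in> bidders M" and Xpos: "0 < bundle_size M (bundle_of M X j)"
    show "bundle_of M X j \<in> restricted_bundles M (bundle_size M (bundle_of M X j))"
      using bundle_of_in_bundles[OF fin(2) assms(2) j] by (simp add: restricted_bundles_def)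
    have Xsize: "bundle_size M (bundle_of M X j) = demand M j"
      using size j Xpos by simp
    then have "j \<in> winners M X"
      using j by (simp add: winners_def bundle_size_bundle_of)
    then have rational: "cost M p (bundle_of M X j) \<le> valuation M j (bundle_of M X j)"
      using ir by (simp add: individually_rational_def)
    have XV: "valuation M j (bundle_of M X j) = reward M j"
      using valuation_bundle_of[OF fin(1) assms(2) j] Xsize by simp
    fix Y assume "Y \<in> restricted_bundles M (bundle_size M (bundle_of M X j))"
    then consider "Y = empty_bundle M" | "Y \<in> bundles M" "bundle_size M Y = demand M j"
      using Xsize by (auto simp: restricted_bundles_def)
    then show "valuation M j Y - cost M p Y
        \<le> valuation M j (bundle_of M X j) - cost M p (bundle_of M X j)"
    proof cases
      case 1
      then show ?thesis
        using rational pos[OF j] by (simp add: valuation_empty_bundle cost_empty_bundle)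
    next
      case 2
      show ?thesis
      proof (cases "\<forall>i\<in>goods M. 0 < Y i \<longrightarrow> (i, j) \<in> edges M")
        case True
        have "cost M p (bundle_of M X j) \<le> cost M p Y"
          unfolding cost_def
        proof (rule sum_mult_le_of_exchange[OF fin(1)])
          show "sum (bundle_of M X j) (goods M) = sum Y (goods M)"
            using Xsize 2 by (simp add: bundle_size_def)
          fix i k
          assume ik: "i \<in> goods M" "k \<in> goods M" "Y i < bundle_of M X j i" "bundle_of M X j k < Y k"
          \<comment> \<open>Together with \<open>X k j < Y k\<close> this gives
            \<open>X k j < copies M k\<close>. Also \<open>0 < Y k\<close>, so \<open>k\<close> is
            an edge good of \<open>j\<close>, and \<open>Y i < X i j\<close> gives
            \<open>0 < X i j\<close>: the premises of the compact condition.\<close>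
          have "Y k \<le> copies M k"
            using 2 ik by (auto simp: bundles_def)
          then show "p i \<le> p k"
            using cc[unfolded compact_condition_def, rule_format, of i j k] ik True j
            by (simp add: bundle_of_def)
        qed
        then show ?thesis
          using valuation_eq_of_bundle_size[OF fin(1) 2(2)] True XV by simp
      next
        case False
        \<comment> \<open>A worthless bundle has net value at most 0 because prices are nonnegative,
          while individual rationality gives the winner's own bundle at least 0.\<close>
        then have "valuation M j Y = 0"
          using valuation_eq_of_bundle_size[OF fin(1) 2(2)] by auto
        then show ?thesis
          using rational cost_nonneg[of M p Y] assms(4) by simp
      qed
    qed
  qed
qed

end
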